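(* Let $D,E,G,H$ be any complex numbers and put $A=-D+E+G+H-3$, $B=-4D+4E+4G+4H-12$, $C=-E-2G-H+4$, $F=-2D-2G-2H+6$, $J=4D-E+2G-H$. Then for every integer $n\ge0$, $$\begin{aligned} &\sum_{\substack{k_1+k_2+k_3+k_4=n\\ k_1,k_2,k_3,k_4\ge 0}}\binom{n}{k_1,k_2,k_3,k_4}T_{k_1}T_{k_2}T_{k_3}T_{k_4}\\ &=\frac{A}{563^2}4^nT_n^{(3052,4658,8804,16451)}-\frac{B}{563}+\frac{C}{563}\sum_{k=0}^n\binom nk3^{n-k}T_{n-k}^{(15,27,48,107)}T_k\\ &\quad+\frac{D}{563^2}\sum_{k=0}^n\binom nk2^nT_{n-k}^{(40,64,215,344)}T_k^{(40,64,215,344)}\\ &\quad+\frac{E}{563}\sum_{k=0}^n\binom nk2^{n-k}T_{n-k}^{(40,64,215,344)}t_k+F\sum_{k=0}^n\binom nkt_{n-k}t_k\\ &\quad+\frac{G}{563}\sum_{\substack{k_1+k_2+k_3=n\\ k_1,k_2,k_3\ge 0}}\binom{n}{k_1,k_2,k_3}2^{k_1}T_{k_1}^{(40,64,215,344)}T_{k_2}T_{k_3}\\ &\quad+H\sum_{\substack{k_1+k_2+k_3=n\\ k_1,k_2,k_3\ge 0}}\binom{n}{k_1,k_2,k_3}t_{k_1}T_{k_2}T_{k_3}\\ &\quad-\frac{J}{563}\sum_{\substack{k_1+k_2+k_3=n\\ k_1,k_2,k_3\ge 0}}\binom{n}{k_1,k_2,k_3}(-1)^{k_1}T_{k_1}^{(-5,2,13,32)}T_{k_2},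 \end{aligned}$$ where $$t_n=\frac12\left(\sum_{k=0}^n\binom nkT_kT_{n-k}-\frac{2^n}{563}T_n^{(40,64,215,344)}\right).$$
   Context: For given $s_0,s_1,s_2,s_3$, the sequence $T_n^{(s_0,s_1,s_2,s_3)}$ is defined by $T_j^{(s_0,s_1,s_2,s_3)}=s_j$ for $0\le j\le 3$ and, for $n\ge4$, each term being the sum of the four preceding terms. The Tetranacci numbers are $T_n=T_n^{(0,1,1,2)}$. The multinomial coefficient is $\binom{n}{k_1,\dots,k_r}=\frac{n!}{k_1!\cdots k_r!}$. *)

theory Defs
  imports Complex_Main
begin

fun gen_tetranacci :: "'a::ab_semigroup_add \<Rightarrow> 'a \<Rightarrow> 'a \<Rightarrow> 'a \<Rightarrow> nat \<Rightarrow> 'a" where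
  "gen_tetranacci s0 s1 s2 s3 0 = s0"
| "gen_tetranacci s0 s1 s2 s3 (Suc 0) = s1"
| "gen_tetranacci s0 s1 s2 s3 (Suc (Suc 0)) = s2"
| "gen_tetranacci s0 s1 s2 s3 (Suc (Suc (Suc 0))) = s3"
| "gen_tetranacci s0 s1 s2 s3 (Suc (Suc (Suc (Suc n)))) =
     gen_tetranacci s0 s1 s2 s3 (Suc (Suc (Suc n))) + gen_tetranacci s0 s1 s2 s3 (Suc (Suc n))
     + gen_tetranacci s0 s1 s2 s3 (Suc n) + gen_tetranacci s0 s1 s2 s3 n"

definition tetranacci :: "nat \<Rightarrow> complex" where
  "tetranacci = gen_tetranacci 0 1 1 2"

(* Only used with sum_list ks = n. *)
definition multinomial :: "nat \<Rightarrow> nat list \<Rightarrow> complex" where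
  "multinomial n ks = fact n / prod_list (map fact ks)"

definition tetranacci_t :: "nat \<Rightarrow> complex" where
  "tetranacci_t n = 1 / 2 *
     ((\<Sum>k=0..n. of_nat (n choose k) * tetranacci k * tetranacci (n - k))
      - 2 ^ n / 563 * gen_tetranacci 40 64 215 344 n)"

end

theory Submission
  imports Defs
    "HOL-Computational_Algebra.Fundamental_Theorem_Algebra"
    "HOL-Computational_Algebra.Formal_Power_Series"
begin

text \<open>
  Let \<open>a, b, c, d\<close> be the complex roots of \<open>z^4 - z^3 - z^2 - z - 1\<close>. Binet's formula
  \<open>T\<^sub>n = w a * a^n + w b * b^n + w c * c^n + w d * d^n\<close> says that the exponential generating function
  of the Tetranacci numbers is \<open>y\<^sub>a + y\<^sub>b + y\<^sub>c + y\<^sub>d\<close>, where \<open>y\<^sub>z\<close> is the weighted exponential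
  \<open>w z * exp (z x)\<close>. Binomial and multinomial convolutions are coefficients of products of such
  generating functions, so the theorem is an identity between symmetric polynomials of degree 4 in
  \<open>y\<^sub>a, y\<^sub>b, y\<^sub>c, y\<^sub>d\<close>, read off at the coefficient of \<open>x^n / n!\<close>.

  The sequences on the right-hand side yield the basic symmetric polynomials of the \<open>y\<^sub>z\<close>, up to
  sign and a power of 563, the absolute value of the discriminant:
  the sequences with initial values \<open>(40, 64, 215, 344)\<close>, \<open>(15, 27, 48, 107)\<close> and
  \<open>(3052, 4658, 8804, 16451)\<close>, dilated by 2, 3 and 4, give the power sums \<open>p2\<close>, \<open>p3\<close> and \<open>p4\<close>,
  and \<open>tetranacci_t\<close> gives the elementary symmetric polynomial \<open>e2 = (e1^2 - p2) / 2\<close>. Since the roots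
  add up to 1 and the weights multiply to \<open>- 1 / 563\<close>, \<open>e4\<close> is a multiple of \<open>exp x\<close>, and \<open>e3\<close>
  is a combination of the series \<open>exp ((1 - z) x)\<close>, which is \<open>exp x\<close> times the generating function of
  the sequence \<open>(-5, 2, 13, 32)\<close> at \<open>- x\<close> (lemmas \<open>egf_p2\<close> to \<open>egf_tetranacci_t\<close>).

  What remains is \<open>fourth_power_symmetric_identity\<close>. Its nine products lie in the
  space of symmetric quartic forms in four variables, which has dimension 5, and they span it.
  Hence they satisfy exactly four independent linear relations, and \<open>D, E, G, H\<close> are the
  coefficients with which these relations are added to one fixed expression of \<open>e1^4\<close>.

  All facts about the weights are calculations in the algebra of polynomials modulo
  \<open>z^4 - z^3 - z^2 - z - 1\<close> followed by a trace: a weighted root sum depends only on the remainder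
  of the weight and on the power sums of the roots (\<open>gen_tetranacci_eq_root_sum\<close>).
\<close>

section \<open>Exponential generating functions\<close>

definition egf :: "(nat \<Rightarrow> 'a::field_char_0) \<Rightarrow> 'a fps" where
  "egf f = Abs_fps (\<lambda>n. f n / fact n)"

text \<open>
  The inverse of \<^term>\<open>egf\<close> one coefficient at a time; as a linear functional it carries identities
  between power series over to identities between convolution sums.
\<close>

definition egf_coeff :: "nat \<Rightarrow> 'a::field_char_0 fps \<Rightarrow> 'a" where
  "egf_coeff n F = fact n * fps_nth F n"

lemma egf_nth: "fps_nth (egf f) n = f n / fact n"
  by (simp add: egf_def)

lemma egf_coeff_egf [simp]: "egf_coeff n (egf f) = f n"
  by (simp add: egf_coeff_def egf_nth)

lemma egf_coeff_linear:
  "egf_coeff n (F + G) = egf_coeff n F + egf_coeff n G"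
  "egf_coeff n (F - G) = egf_coeff n F - egf_coeff n G"
  "egf_coeff n (fps_const k * F) = k * egf_coeff n F"
  by (simp_all add: egf_coeff_def algebra_simps)

lemma egf_one: "egf (\<lambda>n. 1) = fps_exp 1"
  by (simp add: fps_eq_iff egf_nth)

lemma egf_coeff_mult:
  "egf_coeff n (egf f * egf g) = (\<Sum>k=0..n. of_nat (n choose k) * f k * g (n - k))"
  by (auto simp: egf_coeff_def fps_mult_nth egf_nth sum_distrib_left binomial_fact intro!: sum.cong)

text \<open>The reflected form, in which the index of the second factor is the summation variable.\<close>

lemma egf_coeff_mult':
  "egf_coeff n (egf f * egf g) = (\<Sum>k=0..n. of_nat (n choose k) * f (n - k) * g k)"
  by (subst mult.commute, subst egf_coeff_mult) (simp add: mult_ac)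

lemma fps_mult_nth_compositions:
  fixes F G :: "'a::comm_semiring_1 fps"
  shows "fps_nth (F * G) n = (\<Sum>(i, j) \<in> {(i, j). i + j = n}. fps_nth F i * fps_nth G j)"
  unfolding fps_mult_nth
  by (rule sum.reindex_bij_witness[of _ fst "\<lambda>i. (i, n - i)"]) auto

lemma finite_compositions: "finite {(i, j). i + j = (n::nat)}"
  by (rule finite_subset[of _ "{..n} \<times> {..n}"]) auto

text \<open>
  Products of several series are indexed by weak compositions of \<open>n\<close>: the first part \<open>i\<close> is split off,
  and the other parts form a composition of the remaining \<open>m = n - i\<close>.
\<close>

lemma fps_mult_nth_compositions3:
  fixes F G H :: "'a::comm_semiring_1 fps"
  shows "fps_nth (F * G * H) n =
    (\<Sum>(i, j, k) \<in> {(i, j, k). i + j + k = n}. fps_nth F i * fps_nth G j * fps_nth H k)"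
proof -
  have "fps_nth (F * (G * H)) n = (\<Sum>p \<in> {(i, m). i + m = n}.
      \<Sum>q \<in> {(j, k). j + k = snd p}. fps_nth F (fst p) * (fps_nth G (fst q) * fps_nth H (snd q)))"
    by (simp add: fps_mult_nth_compositions case_prod_unfold sum_distrib_left)
  also have "\<dots> = (\<Sum>(p, q) \<in> (SIGMA p:{(i, m). i + m = n}. {(j, k). j + k = snd p}).
      fps_nth F (fst p) * (fps_nth G (fst q) * fps_nth H (snd q)))"
    by (rule sum.Sigma) (auto simp: finite_compositions)
  also have "\<dots> = (\<Sum>(i, j, k) \<in> {(i, j, k). i + j + k = n}. fps_nth F i * fps_nth G j * fps_nth H k)"
    by (rule sum.reindex_bij_witness[of _ "\<lambda>(i, j, k). ((i, j + k), (j, k))" "\<lambda>(p, q). (fst p, q)"])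
       (auto simp: mult_ac)
  finally show ?thesis by (simp add: mult_ac)
qed

lemma finite_compositions3: "finite {(i, j, k). i + j + k = (n::nat)}"
  by (rule finite_subset[of _ "{..n} \<times> {..n} \<times> {..n}"]) auto

lemma fps_mult_nth_compositions4:
  fixes F G H K :: "'a::comm_semiring_1 fps"
  shows "fps_nth (F * G * H * K) n =
    (\<Sum>(i, j, k, l) \<in> {(i, j, k, l). i + j + k + l = n}.
       fps_nth F i * fps_nth G j * fps_nth H k * fps_nth K l)"
proof -
  have "fps_nth (F * (G * H * K)) n = (\<Sum>p \<in> {(i, m). i + m = n}.
      \<Sum>q \<in> {(j, k, l). j + k + l = snd p}.
        fps_nth F (fst p) * (fps_nth G (fst q) * fps_nth H (fst (snd q)) * fps_nth K (snd (snd q))))"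
    unfolding fps_mult_nth_compositions[of F] fps_mult_nth_compositions3
    by (simp add: case_prod_unfold sum_distrib_left)
  also have "\<dots> = (\<Sum>(p, q) \<in> (SIGMA p:{(i, m). i + m = n}. {(j, k, l). j + k + l = snd p}).
      fps_nth F (fst p) * (fps_nth G (fst q) * fps_nth H (fst (snd q)) * fps_nth K (snd (snd q))))"
    by (rule sum.Sigma) (auto simp: finite_compositions finite_compositions3)
  also have "\<dots> = (\<Sum>(i, j, k, l) \<in> {(i, j, k, l). i + j + k + l = n}.
       fps_nth F i * fps_nth G j * fps_nth H k * fps_nth K l)"
    by (rule sum.reindex_bij_witness[of _ "\<lambda>(i, j, k, l). ((i, j + k + l), (j, k, l))"
          "\<lambda>(p, q). (fst p, q)"])
       (auto simp: mult_ac)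
  finally show ?thesis by (simp add: mult_ac)
qed

lemma egf_coeff_mult3:
  "egf_coeff n (egf f * egf g * egf h) =
    (\<Sum>(i, j, k) \<in> {(i, j, k). i + j + k = n}. multinomial n [i, j, k] * f i * g j * h k)"
  unfolding egf_coeff_def fps_mult_nth_compositions3
  by (auto simp: egf_nth multinomial_def sum_distrib_left mult_ac intro!: sum.cong)

lemma egf_coeff_mult4:
  "egf_coeff n (egf f * egf g * egf h * egf u) =
    (\<Sum>(i, j, k, l) \<in> {(i, j, k, l). i + j + k + l = n}.
       multinomial n [i, j, k, l] * f i * g j * h k * u l)"
  unfolding egf_coeff_def fps_mult_nth_compositions4
  by (auto simp: egf_nth multinomial_def sum_distrib_left mult_ac intro!: sum.cong)

section \<open>The roots of the characteristic polynomial\<close>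

text \<open>
  The roots enter only through Vieta's formulas for \<open>z^4 - z^3 - z^2 - z - 1\<close>.
\<close>

locale tetranacci_roots =
  fixes a b c d :: complex
  assumes vieta1: "a + b + c + d = 1"
    and vieta2: "a*b + a*c + a*d + b*c + b*d + c*d = -1"
    and vieta3: "a*b*c + a*b*d + a*c*d + b*c*d = 1"
    and vieta4: "a*b*c*d = -1"

lemma tetranacci_roots_exist: "\<exists>a b c d. tetranacci_roots a b c d"
proof -
  define p :: "complex poly" where "p = [:-1, -1, -1, -1, 1:]"
  have "size (proots p) = Suc (Suc (Suc (Suc 0)))"
    by (simp add: size_proots_complex p_def)
  then obtain a b c d where R: "proots p = {#a, b, c, d#}"
    by (elim size_mset_SucE) auto
  have "smult (lead_coeff p) (\<Prod>x\<in>#proots p. [:-x, 1:]) = p"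
    by (rule complex_poly_decompose_multiset)
  moreover have "lead_coeff p = 1"
    by (simp add: p_def)
  ultimately have "[:-a, 1:] * ([:-b, 1:] * ([:-c, 1:] * [:-d, 1:])) = p"
    by (simp add: R del: mult_pCons_left mult_pCons_right)
  moreover have "[:-a, 1:] * ([:-b, 1:] * ([:-c, 1:] * [:-d, 1:])) =
      [:a*b*c*d, - (a*b*c + a*b*d + a*c*d + b*c*d), a*b + a*c + a*d + b*c + b*d + c*d,
        - (a + b + c + d), 1:]"
    by (simp add: algebra_simps)
  ultimately have "a*b*c*d = -1 \<and> - (a*b*c + a*b*d + a*c*d + b*c*d) = -1
      \<and> a*b + a*c + a*d + b*c + b*d + c*d = -1 \<and> - (a + b + c + d) = -1"
    by (simp only: p_def pCons_eq_iff)
  then have "tetranacci_roots a b c d"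
    unfolding tetranacci_roots_def by (simp only: neg_equal_iff_equal)
  then show ?thesis by blast
qed

text \<open>
  The coefficient of \<open>z^n\<close> in Binet's formula. Continued backwards, the sequence has
  \<open>T\<^sub>-\<^sub>2 = T\<^sub>-\<^sub>1 = T\<^sub>0 = 0\<close> and \<open>T\<^sub>1 = 1\<close>, so this coefficient is \<open>z^2 / P' z\<close> for the characteristic
  polynomial \<open>P\<close>. The cubic below is its polynomial representative modulo \<open>P\<close>, which makes its root
  sums accessible through power sums of the roots.
\<close>

definition weight :: "complex \<Rightarrow> complex" where
  "weight z = (86 * z^3 - 61 * z\<^sup>2 - 71 * z - 87) / 563"

text \<open>
  Reductions modulo the characteristic polynomial. The first equation exhibits the inverse of the
  weight, which is needed for products of three weights; the right-hand sides of the others determine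
  the initial values of the sequences for the second, third and fourth powers.
\<close>

lemma weight_reduce:
  assumes "z^4 = z^3 + z\<^sup>2 + z + 1"
  shows "weight z * (6 * z - z^3 - 1) = 1"
    and "563 * weight z ^ 2 = 6 + 9 * z + 28 * z\<^sup>2 - 11 * z^3"
    and "563 * weight z ^ 3 = (512 + 1958 * z - 1220 * z\<^sup>2 + 1157 * z^3) / 563"
    and "563\<^sup>2 * weight z ^ 4 = 248 - 175 * z + 255 * z\<^sup>2 + 210 * z^3"
proof -
  \<comment> \<open>Clearing the denominator keeps the ideal membership computations integral.\<close>
  define v where "v = 86 * z^3 - 61 * z\<^sup>2 - 71 * z - 87"
  have w: "weight z = v / 563" by (simp add: weight_def v_def)
  have v1: "v * (6 * z - z^3 - 1) = 563"
    using assms unfolding v_def by algebra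
  have v2: "v ^ 2 = 563 * (6 + 9 * z + 28 * z\<^sup>2 - 11 * z^3)"
    using assms unfolding v_def by algebra
  have v3: "v ^ 3 = 563 * (512 + 1958 * z - 1220 * z\<^sup>2 + 1157 * z^3)"
  proof -
    have "v * (6 + 9 * z + 28 * z\<^sup>2 - 11 * z^3) = 512 + 1958 * z - 1220 * z\<^sup>2 + 1157 * z^3"
      using assms unfolding v_def by algebra
    with v2 show ?thesis by algebra
  qed
  have v4: "v ^ 4 = 563\<^sup>2 * (248 - 175 * z + 255 * z\<^sup>2 + 210 * z^3)"
  proof -
    have "(6 + 9 * z + 28 * z\<^sup>2 - 11 * z^3)\<^sup>2 = 248 - 175 * z + 255 * z\<^sup>2 + 210 * z^3"
      using assms by algebra
    with v2 show ?thesis by algebra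
  qed
  show "weight z * (6 * z - z^3 - 1) = 1" using v1 by (simp add: w)
  show "563 * weight z ^ 2 = 6 + 9 * z + 28 * z\<^sup>2 - 11 * z^3"
    using v2 by (simp add: w power_divide)
  show "563 * weight z ^ 3 = (512 + 1958 * z - 1220 * z\<^sup>2 + 1157 * z^3) / 563"
    using v3 by (simp add: w power_divide)
  show "563\<^sup>2 * weight z ^ 4 = 248 - 175 * z + 255 * z\<^sup>2 + 210 * z^3"
    using v4 by (simp add: w power_divide)
qed

context tetranacci_roots
begin

definition root_sum :: "(complex \<Rightarrow> 'a::ab_semigroup_add) \<Rightarrow> 'a" where
  "root_sum f = f a + f b + f c + f d"

lemma root_eq:
  "a^4 = a^3 + a\<^sup>2 + a + 1" "b^4 = b^3 + b\<^sup>2 + b + 1"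
  "c^4 = c^3 + c\<^sup>2 + c + 1" "d^4 = d^3 + d\<^sup>2 + d + 1"
  using vieta1 vieta2 vieta3 vieta4 by algebra+

lemma power_sums:
  "root_sum (\<lambda>z. z) = 1" "root_sum (\<lambda>z. z\<^sup>2) = 3" "root_sum (\<lambda>z. z^3) = 7"
  using vieta1 vieta2 vieta3 unfolding root_sum_def by algebra+

lemma root_sum_cong:
  assumes "\<And>z. z^4 = z^3 + z\<^sup>2 + z + 1 \<Longrightarrow> f z = g z"
  shows "root_sum f = root_sum g"
  by (simp add: root_sum_def assms root_eq)

lemma root_sum_linear:
  fixes f g :: "complex \<Rightarrow> complex"
  shows "root_sum (\<lambda>z. f z + g z) = root_sum f + root_sum g"
    and "root_sum (\<lambda>z. k * f z) = k * root_sum f"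
    and "root_sum (\<lambda>z. k) = 4 * k"
  by (simp_all add: root_sum_def algebra_simps)

lemma root_sum_cubic:
  "root_sum (\<lambda>z. w0 + w1 * z + w2 * z\<^sup>2 + w3 * z^3) = 4 * w0 + w1 + 3 * w2 + 7 * w3"
  by (simp only: root_sum_linear power_sums) simp

text \<open>
  Both sides satisfy the Tetranacci recurrence, so it suffices to compare four initial values.
  The four parameters on the left are the traces of \<open>z^m * (w0 + w1 * z + w2 * z^2 + w3 * z^3)\<close>
  for \<open>m = 0, 1, 2, 3\<close>, and their coefficients 4, 1, 3, 7, 15, 26, 51 are the power sums of the roots.
  Conversely this finds the weight of any sequence by solving a linear system whose determinant is the
  discriminant \<open>- 563\<close>.
\<close>

lemma gen_tetranacci_eq_root_sum:
  "gen_tetranacci (4 * w0 + w1 + 3 * w2 + 7 * w3) (w0 + 3 * w1 + 7 * w2 + 15 * w3)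
     (3 * w0 + 7 * w1 + 15 * w2 + 26 * w3) (7 * w0 + 15 * w1 + 26 * w2 + 51 * w3) n
   = root_sum (\<lambda>z. (w0 + w1 * z + w2 * z\<^sup>2 + w3 * z^3) * z ^ n)"
  (is "gen_tetranacci ?s0 ?s1 ?s2 ?s3 n = root_sum (\<lambda>z. ?w z * z ^ n)")
proof (induction n rule: less_induct)
  case (less n)
  consider "n = 0" | "n = 1" | "n = 2" | "n = 3" | m where "n = m + 4"
  proof -
    have "n = 0 \<or> n = 1 \<or> n = 2 \<or> n = 3 \<or> n = (n - 4) + 4" by linarith
    with that show thesis by blast
  qed
  then show ?case
  proof cases
    case 1
    then show ?thesis by (simp add: root_sum_cubic)
  next
    case 2
    have "root_sum (\<lambda>z. ?w z * z ^ 1) =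
      root_sum (\<lambda>z. w3 + (w0 + w3) * z + (w1 + w3) * z\<^sup>2 + (w2 + w3) * z^3)"
      by (rule root_sum_cong) algebra
    then show ?thesis unfolding 2 root_sum_cubic by simp
  next
    case 3
    have "root_sum (\<lambda>z. ?w z * z ^ 2) =
      root_sum (\<lambda>z. (w2 + w3) + (w2 + 2 * w3) * z + (w0 + w2 + 2 * w3) * z\<^sup>2 + (w1 + w2 + 2 * w3) * z^3)"
      by (rule root_sum_cong) algebra
    then show ?thesis unfolding 3 root_sum_cubic by (simp add: numeral_2_eq_2)
  next
    case 4
    have "root_sum (\<lambda>z. ?w z * z ^ 3) =
      root_sum (\<lambda>z. (w1 + w2 + 2 * w3) + (w1 + 2 * w2 + 3 * w3) * z
        + (w1 + 2 * w2 + 4 * w3) * z\<^sup>2 + (w0 + w1 + 2 * w2 + 4 * w3) * z^3)"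
      by (rule root_sum_cong) algebra
    then show ?thesis unfolding 4 root_sum_cubic by (simp add: numeral_3_eq_3)
  next
    case 5
    have "root_sum (\<lambda>z. ?w z * z ^ n) =
      root_sum (\<lambda>z. ?w z * z ^ (m + 3) + ?w z * z ^ (m + 2) + ?w z * z ^ (m + 1) + ?w z * z ^ m)"
    proof (rule root_sum_cong)
      fix z :: complex
      assume z: "z^4 = z^3 + z\<^sup>2 + z + 1"
      show "?w z * z ^ n = ?w z * z ^ (m + 3) + ?w z * z ^ (m + 2) + ?w z * z ^ (m + 1) + ?w z * z ^ m"
        by (simp only: 5 power_add z) (simp add: algebra_simps)
    qed
    also have "\<dots> = gen_tetranacci ?s0 ?s1 ?s2 ?s3 (m + 3) + gen_tetranacci ?s0 ?s1 ?s2 ?s3 (m + 2)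
        + gen_tetranacci ?s0 ?s1 ?s2 ?s3 (m + 1) + gen_tetranacci ?s0 ?s1 ?s2 ?s3 m"
      unfolding root_sum_linear using less 5 by simp
    also have "\<dots> = gen_tetranacci ?s0 ?s1 ?s2 ?s3 n"
      by (simp add: 5 eval_nat_numeral)
    finally show ?thesis by simp
  qed
qed

lemma gen_tetranacci_root_sum:
  shows "tetranacci n = root_sum (\<lambda>z. weight z * z ^ n)"
    and "gen_tetranacci 40 64 215 344 n = root_sum (\<lambda>z. 563 * weight z ^ 2 * z ^ n)"
    and "gen_tetranacci 15 27 48 107 n = root_sum (\<lambda>z. 563 * weight z ^ 3 * z ^ n)"
    and "gen_tetranacci 3052 4658 8804 16451 n = root_sum (\<lambda>z. 563\<^sup>2 * weight z ^ 4 * z ^ n)"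
    and "gen_tetranacci (-5) 2 13 32 n = root_sum (\<lambda>z. (6 * z - z^3 - 1) * z ^ n)"
proof -
  show "tetranacci n = root_sum (\<lambda>z. weight z * z ^ n)"
  proof -
    have "weight z = -87/563 + (-71/563) * z + (-61/563) * z\<^sup>2 + 86/563 * z^3" for z
      by (simp add: weight_def field_simps)
    then show ?thesis
      using gen_tetranacci_eq_root_sum[of "-87/563" "-71/563" "-61/563" "86/563" n]
      by (simp add: tetranacci_def)
  qed
  show "gen_tetranacci 40 64 215 344 n = root_sum (\<lambda>z. 563 * weight z ^ 2 * z ^ n)"
  proof -
    have "root_sum (\<lambda>z. 563 * weight z ^ 2 * z ^ n) =
        root_sum (\<lambda>z. (6 + 9 * z + 28 * z\<^sup>2 + (-11) * z^3) * z ^ n)"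
      by (rule root_sum_cong) (simp add: weight_reduce)
    then show ?thesis using gen_tetranacci_eq_root_sum[of 6 9 28 "-11" n] by simp
  qed
  show "gen_tetranacci 15 27 48 107 n = root_sum (\<lambda>z. 563 * weight z ^ 3 * z ^ n)"
  proof -
    have "root_sum (\<lambda>z. 563 * weight z ^ 3 * z ^ n) =
        root_sum (\<lambda>z. (512/563 + 1958/563 * z + (-1220/563) * z\<^sup>2 + 1157/563 * z^3) * z ^ n)"
    proof (rule root_sum_cong)
      fix z :: complex
      assume "z^4 = z^3 + z\<^sup>2 + z + 1"
      from weight_reduce(3)[OF this]
      have "563 * weight z ^ 3 = 512/563 + 1958/563 * z + (-1220/563) * z\<^sup>2 + 1157/563 * z^3"
        by (simp add: add_divide_distrib diff_divide_distrib)
      then show "563 * weight z ^ 3 * z ^ n =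
          (512/563 + 1958/563 * z + (-1220/563) * z\<^sup>2 + 1157/563 * z^3) * z ^ n"
        by simp
    qed
    then show ?thesis
      using gen_tetranacci_eq_root_sum[of "512/563" "1958/563" "-1220/563" "1157/563" n] by simp
  qed
  show "gen_tetranacci 3052 4658 8804 16451 n = root_sum (\<lambda>z. 563\<^sup>2 * weight z ^ 4 * z ^ n)"
  proof -
    have "root_sum (\<lambda>z. 563\<^sup>2 * weight z ^ 4 * z ^ n) =
        root_sum (\<lambda>z. (248 + (-175) * z + 255 * z\<^sup>2 + 210 * z^3) * z ^ n)"
      by (rule root_sum_cong) (simp only: weight_reduce, simp)
    then show ?thesis using gen_tetranacci_eq_root_sum[of 248 "-175" 255 210 n] by simp
  qed
  show "gen_tetranacci (-5) 2 13 32 n = root_sum (\<lambda>z. (6 * z - z^3 - 1) * z ^ n)"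
    using gen_tetranacci_eq_root_sum[of "-1" 6 0 "-1" n] by (simp add: algebra_simps)
qed

text \<open>
  Newton's identities express \<open>24 * e4\<close> by power sums; as the weights add up to \<open>T\<^sub>0 = 0\<close>, only
  \<open>3 * p2^2 - 6 * p4\<close> survives. The power sums of the weights are the initial terms of the
  corresponding sequences, so that \<open>24 * e4 = (3 * 40^2 - 6 * 3052) / 563^2 = - 24 / 563\<close>.
\<close>

lemma weight_prod: "weight a * weight b * weight c * weight d = - 1 / 563"
proof -
  have p1: "root_sum weight = 0"
    using gen_tetranacci_root_sum(1)[of 0] by (simp add: tetranacci_def)
  have p2: "563 * root_sum (\<lambda>z. weight z ^ 2) = 40"
    using gen_tetranacci_root_sum(2)[of 0] by (simp add: root_sum_linear)
  have p4: "563\<^sup>2 * root_sum (\<lambda>z. weight z ^ 4) = 3052"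
    using gen_tetranacci_root_sum(4)[of 0] by (simp add: root_sum_linear)
  have "24 * (weight a * weight b * weight c * weight d) =
      3 * (root_sum (\<lambda>z. weight z ^ 2))\<^sup>2 - 6 * root_sum (\<lambda>z. weight z ^ 4)"
    using p1 unfolding root_sum_def by algebra
  also have "root_sum (\<lambda>z. weight z ^ 2) = 40 / 563"
    using arg_cong[OF p2, of "\<lambda>x. x / 563"] by simp
  also have "root_sum (\<lambda>z. weight z ^ 4) = 3052 / 563\<^sup>2"
    using arg_cong[OF p4, of "\<lambda>x. x / 563\<^sup>2"] by simp
  finally have "24 * (weight a * weight b * weight c * weight d) = 24 * (- 1 / 563)"
    by (simp add: power2_eq_square)
  then show ?thesis by (subst (asm) mult_left_cancel) simp_all
qed

text \<open>Each product is the product of all four weights times the inverse of the missing one.\<close>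

lemma weight_prod3:
  "weight b * weight c * weight d = - (6 * a - a^3 - 1) / 563"
  "weight a * weight c * weight d = - (6 * b - b^3 - 1) / 563"
  "weight a * weight b * weight d = - (6 * c - c^3 - 1) / 563"
  "weight a * weight b * weight c = - (6 * d - d^3 - 1) / 563"
proof -
  have *: "q = - u / 563" if "w * u = 1" "w * q = - 1 / 563" for w q u :: complex
  proof -
    have "q = u * (w * q)" using that(1) by (simp add: mult_ac flip: mult.assoc)
    also have "\<dots> = - u / 563" by (simp add: that(2))
    finally show ?thesis .
  qed
  show "weight b * weight c * weight d = - (6 * a - a^3 - 1) / 563"
    by (rule *[OF weight_reduce(1)[OF root_eq(1)]]) (use weight_prod in \<open>simp add: mult_ac\<close>)
  show "weight a * weight c * weight d = - (6 * b - b^3 - 1) / 563"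
    by (rule *[OF weight_reduce(1)[OF root_eq(2)]]) (use weight_prod in \<open>simp add: mult_ac\<close>)
  show "weight a * weight b * weight d = - (6 * c - c^3 - 1) / 563"
    by (rule *[OF weight_reduce(1)[OF root_eq(3)]]) (use weight_prod in \<open>simp add: mult_ac\<close>)
  show "weight a * weight b * weight c = - (6 * d - d^3 - 1) / 563"
    by (rule *[OF weight_reduce(1)[OF root_eq(4)]]) (use weight_prod in \<open>simp add: mult_ac\<close>)
qed

section \<open>Generating functions as symmetric polynomials in weighted exponentials\<close>

definition weighted_exp :: "complex \<Rightarrow> complex fps" where
  "weighted_exp z = fps_const (weight z) * fps_exp z"

lemma weighted_exp_power:
  "weighted_exp z ^ k = fps_const (weight z ^ k) * fps_exp (of_nat k * z)"
  by (simp add: weighted_exp_def power_mult_distrib fps_exp_power_mult fps_const_power)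

lemma egf_root_sum:
  "egf (\<lambda>n. r ^ n * root_sum (\<lambda>z. f z * z ^ n)) = root_sum (\<lambda>z. fps_const (f z) * fps_exp (r * z))"
  by (simp add: root_sum_def fps_eq_iff egf_nth algebra_simps power_mult_distrib add_divide_distrib)

text \<open>
  The \<open>k\<close>-th power of a weighted exponential has \<open>exp (k z x)\<close> as its exponential part, which is why the
  sequences belonging to power sums occur with the factor \<open>k^n\<close>.
\<close>

lemma egf_weight_power:
  assumes "\<And>n. s n = root_sum (\<lambda>z. m * weight z ^ k * z ^ n)"
  shows "egf (\<lambda>n. of_nat k ^ n * s n) = fps_const m * root_sum (\<lambda>z. weighted_exp z ^ k)"
  unfolding assms egf_root_sum weighted_exp_power
  by (simp add: root_sum_def algebra_simps flip: fps_const_mult)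

abbreviation "e1 \<equiv> root_sum weighted_exp"
abbreviation "p2 \<equiv> root_sum (\<lambda>z. weighted_exp z ^ 2)"
abbreviation "p3 \<equiv> root_sum (\<lambda>z. weighted_exp z ^ 3)"
abbreviation "p4 \<equiv> root_sum (\<lambda>z. weighted_exp z ^ 4)"
abbreviation "e2 \<equiv> weighted_exp a * weighted_exp b + weighted_exp a * weighted_exp c
  + weighted_exp a * weighted_exp d + weighted_exp b * weighted_exp c
  + weighted_exp b * weighted_exp d + weighted_exp c * weighted_exp d"
abbreviation "e3 \<equiv> weighted_exp b * weighted_exp c * weighted_exp d
  + weighted_exp a * weighted_exp c * weighted_exp d
  + weighted_exp a * weighted_exp b * weighted_exp d
  + weighted_exp a * weighted_exp b * weighted_exp c"
abbreviation "e4 \<equiv> weighted_exp a * weighted_exp b * weighted_exp c * weighted_exp d"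

lemma egf_tetranacci: "egf tetranacci = e1"
proof -
  have "tetranacci n = root_sum (\<lambda>z. 1 * weight z ^ 1 * z ^ n)" for n
    by (simp add: gen_tetranacci_root_sum(1))
  from egf_weight_power[of tetranacci, OF this] show ?thesis by simp
qed

lemma egf_p2: "egf (\<lambda>n. 2 ^ n * gen_tetranacci 40 64 215 344 n) = fps_const 563 * p2"
  using egf_weight_power[of _ 563 2] gen_tetranacci_root_sum(2) by simp

lemma egf_p3: "egf (\<lambda>n. 3 ^ n * gen_tetranacci 15 27 48 107 n) = fps_const 563 * p3"
  using egf_weight_power[of _ 563 3] gen_tetranacci_root_sum(3) by simp

lemma egf_p4: "egf (\<lambda>n. 4 ^ n * gen_tetranacci 3052 4658 8804 16451 n) = fps_const (563\<^sup>2) * p4"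
  using egf_weight_power[of _ "563\<^sup>2" 4] gen_tetranacci_root_sum(4) by simp

lemma weighted_exp_prod3:
  "weighted_exp x * weighted_exp y * weighted_exp z =
   fps_const (weight x * weight y * weight z) * fps_exp (x + y + z)"
  by (simp add: weighted_exp_def fps_exp_add_mult mult_ac flip: fps_const_mult)

text \<open>The exponents of the four exponentials add up to 1, by Vieta.\<close>

lemma egf_e4: "egf (\<lambda>n. 1) = fps_const (-563) * e4"
proof -
  have "e4 = fps_const (weight a * weight b * weight c * weight d) * fps_exp (a + b + c + d)"
    by (simp add: weighted_exp_def fps_exp_add_mult mult_ac flip: fps_const_mult)
  also have "\<dots> = fps_const (- 1 / 563) * fps_exp 1"
    by (simp only: weight_prod vieta1)
  finally have e4: "e4 = fps_const (- 1 / 563) * fps_exp 1" .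
  show ?thesis
    by (simp only: e4 egf_one) (simp flip: mult.assoc)
qed

text \<open>
  Omitting the root \<open>z\<close> leaves the exponent \<open>1 - z\<close> and, by \<open>weight_prod3\<close>, the coefficient
  \<open>- (6 * z - z^3 - 1) / 563\<close>. The factor \<open>exp x\<close> that splits off is the generating function of the
  constant sequence 1; it accounts for the missing factor with index \<open>k3\<close> in the last sum of
  the theorem.
\<close>

lemma egf_e3:
  "egf (\<lambda>n. (-1) ^ n * gen_tetranacci (-5) 2 13 32 n) * egf (\<lambda>n. 1) = fps_const (-563) * e3"
proof -
  have *: "fps_exp (- z) * fps_exp 1 = fps_exp (1 - z)" for z :: complex
    by (simp flip: fps_exp_add_mult)
  have **: "b + c + d = 1 - a" "a + c + d = 1 - b" "a + b + d = 1 - c" "a + b + c = 1 - d"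
    using vieta1 by algebra+
  have ***: "- 563 * (- u / 563) = u" for u :: complex by simp
  have "egf (\<lambda>n. (-1) ^ n * gen_tetranacci (-5) 2 13 32 n) =
      root_sum (\<lambda>z. fps_const (6 * z - z^3 - 1) * fps_exp (- z))"
    unfolding gen_tetranacci_root_sum egf_root_sum by simp
  then have "egf (\<lambda>n. (-1) ^ n * gen_tetranacci (-5) 2 13 32 n) * egf (\<lambda>n. 1) =
      root_sum (\<lambda>z. fps_const (6 * z - z^3 - 1) * fps_exp (1 - z))"
    by (simp only: egf_one root_sum_def distrib_right mult.assoc *)
  also have "\<dots> = fps_const (-563) * e3"
    unfolding weighted_exp_prod3 weight_prod3 ** distrib_left mult.assoc[symmetric] fps_const_mult ***
    by (simp only: root_sum_def)
  finally show ?thesis .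
qed

lemma egf_tetranacci_t: "egf tetranacci_t = e2"
proof -
  have "fps_const 2 * egf tetranacci_t = egf tetranacci * egf tetranacci
      - fps_const (1 / 563) * egf (\<lambda>n. 2 ^ n * gen_tetranacci 40 64 215 344 n)"
    (is "?l = ?r")
  proof (rule fps_ext)
    fix n
    have "egf_coeff n ?l = egf_coeff n ?r"
      unfolding egf_coeff_linear egf_coeff_mult egf_coeff_egf by (simp add: tetranacci_t_def)
    then show "fps_nth ?l n = fps_nth ?r n" by (simp add: egf_coeff_def)
  qed
  also have "\<dots> = e1 * e1 - p2"
    by (simp add: egf_tetranacci egf_p2 flip: mult.assoc)
  also have "\<dots> = 2 * e2"
    unfolding root_sum_def by algebra
  finally show ?thesis by (simp add: numeral_fps_const)
qed

end

section \<open>The convolution identity\<close>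

text \<open>
  The forms \<open>p4\<close>, \<open>e4\<close>, \<open>p3 * e1\<close>, \<open>e2^2\<close>, \<open>e3 * e1\<close> are a basis (over the rationals) of the symmetric
  quartic forms in four variables. The remaining products \<open>p2^2\<close>, \<open>p2 * e2\<close>, \<open>p2 * e1^2\<close>, \<open>e2 * e1^2\<close>
  each give one linear relation, weighted by \<open>D\<close>, \<open>E\<close>, \<open>G\<close>, \<open>H\<close> respectively.
\<close>

lemma fourth_power_symmetric_identity:
  fixes x y z w D E G H :: "'a::idom"
  defines "e1 \<equiv> x + y + z + w"
    and "p2 \<equiv> x^2 + y^2 + z^2 + w^2"
    and "p3 \<equiv> x^3 + y^3 + z^3 + w^3"
    and "p4 \<equiv> x^4 + y^4 + z^4 + w^4"
    and "e2 \<equiv> x*y + x*z + x*w + y*z + y*w + z*w"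
    and "e3 \<equiv> y*z*w + x*z*w + x*y*w + x*y*z"
    and "e4 \<equiv> x*y*z*w"
  shows "e1 * e1 * e1 * e1 = (- D + E + G + H - 3) * p4 + (- 4 * D + 4 * E + 4 * G + 4 * H - 12) * e4
    + (- E - 2 * G - H + 4) * (p3 * e1) + D * (p2 * p2) + E * (p2 * e2)
    + (- 2 * D - 2 * G - 2 * H + 6) * (e2 * e2) + G * (p2 * e1 * e1) + H * (e2 * e1 * e1)
    + (4 * D - E + 2 * G - H) * (e3 * e1)"
proof -
  have "e1 * e1 * e1 * e1 = - 3 * p4 - 12 * e4 + 4 * (p3 * e1) + 6 * (e2 * e2)"
    unfolding assms by algebra
  \<comment> \<open>These four relations are the coefficients of \<open>D\<close>, \<open>E\<close>, \<open>G\<close> and \<open>H\<close> in the claim.\<close>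
  moreover have "- p4 - 4 * e4 + p2 * p2 - 2 * (e2 * e2) + 4 * (e3 * e1) = 0"
    unfolding assms by algebra
  moreover have "p4 + 4 * e4 - p3 * e1 + p2 * e2 - e3 * e1 = 0"
    unfolding assms by algebra
  moreover have "p4 + 4 * e4 - 2 * (p3 * e1) - 2 * (e2 * e2) + p2 * e1 * e1 + 2 * (e3 * e1) = 0"
    unfolding assms by algebra
  moreover have "p4 + 4 * e4 - p3 * e1 - 2 * (e2 * e2) + e2 * e1 * e1 - e3 * e1 = 0"
    unfolding assms by algebra
  ultimately show ?thesis by algebra
qed

theorem theorem4:
  fixes A B C D E F G H J :: complex and n :: nat
  assumes "A = - D + E + G + H - 3"
    and "B = - 4 * D + 4 * E + 4 * G + 4 * H - 12"
    and "C = - E - 2 * G - H + 4"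
    and "F = - 2 * D - 2 * G - 2 * H + 6"
    and "J = 4 * D - E + 2 * G - H"
  shows "(\<Sum>(k1, k2, k3, k4) \<in> {(k1, k2, k3, k4). k1 + k2 + k3 + k4 = n}.
            multinomial n [k1, k2, k3, k4]
              * tetranacci k1 * tetranacci k2 * tetranacci k3 * tetranacci k4)
       = A / 563\<^sup>2 * 4 ^ n * gen_tetranacci 3052 4658 8804 16451 n
       - B / 563
       + C / 563 * (\<Sum>k=0..n. of_nat (n choose k) * 3 ^ (n - k)
            * gen_tetranacci 15 27 48 107 (n - k) * tetranacci k)
       + D / 563\<^sup>2 * (\<Sum>k=0..n. of_nat (n choose k) * 2 ^ n
            * gen_tetranacci 40 64 215 344 (n - k) * gen_tetranacci 40 64 215 344 k)
       + E / 563 * (\<Sum>k=0..n. of_nat (n choose k) * 2 ^ (n - k)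
            * gen_tetranacci 40 64 215 344 (n - k) * tetranacci_t k)
       + F * (\<Sum>k=0..n. of_nat (n choose k) * tetranacci_t (n - k) * tetranacci_t k)
       + G / 563 * (\<Sum>(k1, k2, k3) \<in> {(k1, k2, k3). k1 + k2 + k3 = n}.
            multinomial n [k1, k2, k3] * 2 ^ k1
              * gen_tetranacci 40 64 215 344 k1 * tetranacci k2 * tetranacci k3)
       + H * (\<Sum>(k1, k2, k3) \<in> {(k1, k2, k3). k1 + k2 + k3 = n}.
            multinomial n [k1, k2, k3] * tetranacci_t k1 * tetranacci k2 * tetranacci k3)
       - J / 563 * (\<Sum>(k1, k2, k3) \<in> {(k1, k2, k3). k1 + k2 + k3 = n}.
            multinomial n [k1, k2, k3] * (- 1) ^ k1
              * gen_tetranacci (- 5) 2 13 32 k1 * tetranacci k2)"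
proof -
  obtain a b c d where "tetranacci_roots a b c d"
    using tetranacci_roots_exist by blast
  then interpret tetranacci_roots a b c d .
  let ?k = "fps_const :: complex \<Rightarrow> complex fps"
  define L :: "complex fps \<Rightarrow> complex" where "L = egf_coeff n"
  have T4: "(\<Sum>(k1, k2, k3, k4) \<in> {(k1, k2, k3, k4). k1 + k2 + k3 + k4 = n}.
      multinomial n [k1, k2, k3, k4]
        * tetranacci k1 * tetranacci k2 * tetranacci k3 * tetranacci k4) = L (e1 * e1 * e1 * e1)"
    unfolding L_def egf_tetranacci[symmetric] egf_coeff_mult4 ..
  have S1: "4 ^ n * gen_tetranacci 3052 4658 8804 16451 n = 563\<^sup>2 * L p4"
    unfolding L_def egf_coeff_linear(3)[symmetric] egf_p4[symmetric] by simp
  have S2: "- 563 * L e4 = 1"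
    unfolding L_def egf_coeff_linear(3)[symmetric] egf_e4[symmetric] by simp
  have S3: "(\<Sum>k=0..n. of_nat (n choose k) * 3 ^ (n - k)
      * gen_tetranacci 15 27 48 107 (n - k) * tetranacci k) = 563 * L (p3 * e1)"
    unfolding L_def egf_coeff_linear(3)[symmetric] mult.assoc[symmetric]
      egf_p3[symmetric] egf_tetranacci[symmetric] egf_coeff_mult' ..
  \<comment> \<open>Each of the two factors contributes its own dilation, and \<open>2^(n - k) * 2^k = 2^n\<close>.\<close>
  have S4: "(\<Sum>k=0..n. of_nat (n choose k) * 2 ^ n
      * gen_tetranacci 40 64 215 344 (n - k) * gen_tetranacci 40 64 215 344 k)
      = 563\<^sup>2 * L (p2 * p2)"
  proof -
    have "?k (563\<^sup>2) = ?k 563 * ?k 563"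
      by simp
    then have "?k (563\<^sup>2) * (p2 * p2) = (?k 563 * p2) * (?k 563 * p2)"
      by (simp only: mult_ac)
    then have "563\<^sup>2 * L (p2 * p2) = L ((?k 563 * p2) * (?k 563 * p2))"
      unfolding L_def egf_coeff_linear(3)[symmetric] by (simp only:)
    also have "\<dots> = (\<Sum>k=0..n. of_nat (n choose k)
        * (2 ^ (n - k) * gen_tetranacci 40 64 215 344 (n - k))
        * (2 ^ k * gen_tetranacci 40 64 215 344 k))"
      unfolding L_def egf_p2[symmetric] egf_coeff_mult' ..
    also have "\<dots> = (\<Sum>k=0..n. of_nat (n choose k) * 2 ^ n
        * gen_tetranacci 40 64 215 344 (n - k) * gen_tetranacci 40 64 215 344 k)"
    proof (rule sum.cong)
      fix k
      assume "k \<in> {0..n}"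
      then have "(2::complex) ^ n = 2 ^ (n - k) * 2 ^ k" by (simp flip: power_add)
      then show "of_nat (n choose k) * (2 ^ (n - k) * gen_tetranacci 40 64 215 344 (n - k))
          * (2 ^ k * gen_tetranacci 40 64 215 344 k) = of_nat (n choose k) * 2 ^ n
          * gen_tetranacci 40 64 215 344 (n - k) * (gen_tetranacci 40 64 215 344 k :: complex)"
        by (simp only: mult_ac)
    qed simp
    finally show ?thesis by simp
  qed
  have S5: "(\<Sum>k=0..n. of_nat (n choose k) * 2 ^ (n - k)
      * gen_tetranacci 40 64 215 344 (n - k) * tetranacci_t k) = 563 * L (p2 * e2)"
    unfolding L_def egf_coeff_linear(3)[symmetric] mult.assoc[symmetric]
      egf_p2[symmetric] egf_tetranacci_t[symmetric] egf_coeff_mult' ..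
  have S6: "(\<Sum>k=0..n. of_nat (n choose k) * tetranacci_t (n - k) * tetranacci_t k) = L (e2 * e2)"
    unfolding L_def egf_tetranacci_t[symmetric] egf_coeff_mult' ..
  have S7: "(\<Sum>(k1, k2, k3) \<in> {(k1, k2, k3). k1 + k2 + k3 = n}.
      multinomial n [k1, k2, k3] * 2 ^ k1
        * gen_tetranacci 40 64 215 344 k1 * tetranacci k2 * tetranacci k3) = 563 * L (p2 * e1 * e1)"
    unfolding L_def egf_coeff_linear(3)[symmetric] mult.assoc[symmetric]
      egf_p2[symmetric] egf_tetranacci[symmetric] egf_coeff_mult3 ..
  have S8: "(\<Sum>(k1, k2, k3) \<in> {(k1, k2, k3). k1 + k2 + k3 = n}.
      multinomial n [k1, k2, k3] * tetranacci_t k1 * tetranacci k2 * tetranacci k3)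
      = L (e2 * e1 * e1)"
    unfolding L_def egf_tetranacci_t[symmetric] egf_tetranacci[symmetric] egf_coeff_mult3 ..
  have S9: "(\<Sum>(k1, k2, k3) \<in> {(k1, k2, k3). k1 + k2 + k3 = n}.
      multinomial n [k1, k2, k3] * (- 1) ^ k1
        * gen_tetranacci (- 5) 2 13 32 k1 * tetranacci k2) = - 563 * L (e3 * e1)"
  proof -
    \<comment> \<open>The missing third factor is the constant sequence 1.\<close>
    let ?u = "\<lambda>n. (- 1) ^ n * gen_tetranacci (- 5) 2 13 32 n :: complex"
    have "- 563 * L (e3 * e1) = L (egf ?u * egf tetranacci * egf (\<lambda>n. 1))"
      unfolding L_def egf_coeff_linear(3)[symmetric] mult.assoc[symmetric]
        egf_e3[symmetric] egf_tetranacci[symmetric]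
      by (simp add: mult_ac)
    also have "\<dots> = (\<Sum>(k1, k2, k3) \<in> {(k1, k2, k3). k1 + k2 + k3 = n}.
        multinomial n [k1, k2, k3] * (- 1) ^ k1
          * gen_tetranacci (- 5) 2 13 32 k1 * tetranacci k2)"
      unfolding L_def egf_coeff_mult3 by (simp add: mult.assoc)
    finally show ?thesis by simp
  qed
  have coeffs:
    "?k A = - ?k D + ?k E + ?k G + ?k H - 3"
    "?k B = - 4 * ?k D + 4 * ?k E + 4 * ?k G + 4 * ?k H - 12"
    "?k C = - ?k E - 2 * ?k G - ?k H + 4"
    "?k F = - 2 * ?k D - 2 * ?k G - 2 * ?k H + 6"
    "?k J = 4 * ?k D - ?k E + 2 * ?k G - ?k H"
    by (simp_all add: assms numeral_fps_const)
  have "e1 * e1 * e1 * e1 = ?k A * p4 + ?k B * e4 + ?k C * (p3 * e1) + ?k D * (p2 * p2)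
      + ?k E * (p2 * e2) + ?k F * (e2 * e2) + ?k G * (p2 * e1 * e1) + ?k H * (e2 * e1 * e1)
      + ?k J * (e3 * e1)"
    unfolding coeffs root_sum_def by (rule fourth_power_symmetric_identity)
  then have main: "L (e1 * e1 * e1 * e1) = A * L p4 + B * L e4 + C * L (p3 * e1) + D * L (p2 * p2)
      + E * L (p2 * e2) + F * L (e2 * e2) + G * L (p2 * e1 * e1) + H * L (e2 * e1 * e1)
      + J * L (e3 * e1)"
    unfolding L_def by (simp only: egf_coeff_linear)
  have B: "- B / 563 = B * L e4"
  proof -
    have "B * L e4 = (- 563 * L e4) * (- B / 563)" by simp
    then show ?thesis by (simp only: S2 mult_1)
  qed
  have A: "A / 563\<^sup>2 * 4 ^ n * gen_tetranacci 3052 4658 8804 16451 n = A * L p4"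
    unfolding mult.assoc S1 by simp
  show ?thesis
    unfolding T4 A S3 S4 S5 S6 S7 S8 S9 main using B by simp
qed

end
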